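(* Let $k > 1$ be an integer, let $q$ be a prime power and let $D$ be a positive integer such that $$\frac{N(k+1,q)}{q^k + q^{k-1} + \cdots + q} > \left\lfloor \frac{D}{k+1} \right\rfloor .$$ Then for any set $\mathcal F \subseteq \mathbb F_q[T]$ of non-zero polynomials, of size at most $\frac{q^{k+1}-1}{q-1} - 1$, all of whose degrees are at most $D$, one has $\delta(\mathcal F) \ge q^{-k}$.
   Context: $N(m,q)$ denotes the number of irreducible monic polynomials of degree $m$ over $\mathbb F_q$, the field with $q$ elements. $\mathbb F_q((T^{-1}))$ is the field of formal Laurent series $\alpha = \sum_{i=-\infty}^{n} x_i T^i$ in $T^{-1}$. For such $\alpha$, $\mathrm{ord}(\alpha)$ is the greatest $i$ with $x_i \neq 0$, and $\langle \alpha \rangle = q^{\mathrm{ord}(\alpha)}$, with $\mathrm{ord}(0) = -\infty$ and $\langle 0 \rangle = 0$. Put $\mathbb T = \{\alpha \in \mathbb F_q((T^{-1})) : \langle \alpha \rangle < 1\}$. Each $\alpha$ decomposes uniquely as $\alpha = [\alpha] + \|\alpha\|$ with $[\alpha] \in \mathbb F_q[T]$ and $\|\alpha\| \in \mathbb T$; write $|\alpha| := \langle \|\alpha\| \rangle$. The loneliness of $\mathcal F \subseteq \mathbb F_q[T] \setminus \{0\}$ is $\delta(\mathcal F) := \sup_{\alpha \in \mathbb T} \min_{f \in \mathcal F} |\alpha f|$ (a minimum over the empty set is read as $+\infty$). *)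

theory Defs
  imports
    "HOL-Library.Cardinality"
    "HOL-Library.Extended_Real"
    "HOL-Computational_Algebra.Formal_Laurent_Series"
begin

unbundle fps_syntax

(* The field F_q is a type 'a of sort {field, finite}, with q = CARD('a).  The variable of the
   Laurent series type 'a fls plays the role of T^(-1): the coefficient of T^i in
   alpha is alpha $$ (- i), and T itself is fls_X_inv. *)

definition num_irreducible_monic :: "'a::{field, finite} itself \<Rightarrow> nat \<Rightarrow> nat" where
  "num_irreducible_monic _ m =
     card {p :: 'a poly. irreducible p \<and> lead_coeff p = 1 \<and> degree p = m}"

definition laurent_of_poly :: "'a::field poly \<Rightarrow> 'a fls" where
  "laurent_of_poly f = poly (map_poly fls_const f) fls_X_inv"

(* Only meaningful for nonzero series: the convention ord(0) = -infinity is not encoded here but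
   in the zero case of angle_norm. *)
definition laurent_ord :: "'a::field fls \<Rightarrow> int" where
  "laurent_ord \<alpha> = - fls_subdegree \<alpha>"

definition angle_norm :: "'a::{field, finite} fls \<Rightarrow> real" where
  "angle_norm \<alpha> = (if \<alpha> = 0 then 0 else real CARD('a) powi laurent_ord \<alpha>)"

definition laurent_torus :: "'a::{field, finite} fls set" where
  "laurent_torus = {\<alpha>. angle_norm \<alpha> < 1}"

(* fls_prpart collects the coefficients of the positive powers of T, without the constant one. *)
definition poly_part :: "'a::field fls \<Rightarrow> 'a poly" where
  "poly_part \<alpha> = fls_prpart \<alpha> + [:\<alpha> $$ 0:]"

definition frac_part :: "'a::field fls \<Rightarrow> 'a fls" where
  "frac_part \<alpha> = \<alpha> - laurent_of_poly (poly_part \<alpha>)"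

definition frac_norm :: "'a::{field, finite} fls \<Rightarrow> real" where
  "frac_norm \<alpha> = angle_norm (frac_part \<alpha>)"

(* For finite nonempty F the infimum is a minimum; for empty F it is infinity. *)
definition loneliness :: "'a::{field, finite} poly set \<Rightarrow> ereal" where
  "loneliness F =
     (SUP \<alpha>\<in>laurent_torus. INF f\<in>F. ereal (frac_norm (\<alpha> * laurent_of_poly f)))"

lemma laurent_of_poly_nth:
  "laurent_of_poly f $$ n = (if n \<le> 0 then coeff f (nat (- n)) else 0)"
proof (induction f arbitrary: n rule: pCons_induct)
  case 0
  show ?case by (simp add: laurent_of_poly_def)
next
  case (pCons a f)
  have "laurent_of_poly (pCons a f) = fls_const a + fls_X_inv * laurent_of_poly f"
    using pCons.hyps by (simp add: laurent_of_poly_def map_poly_pCons)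
  hence "laurent_of_poly (pCons a f) $$ n = fls_const a $$ n + laurent_of_poly f $$ (n + 1)"
    by (simp add: fls_X_inv_times_conv_shift)
  moreover have "nat (- n) = Suc (nat (- (n + 1)))" if "n < 0"
    using that by simp
  ultimately show ?case
    by (cases "n < 0") (auto simp: pCons.IH coeff_pCons split: nat.split)
qed

lemma laurent_torus_iff:
  fixes \<alpha> :: "'a::{field, finite} fls"
  shows "\<alpha> \<in> laurent_torus \<longleftrightarrow> (\<forall>n\<le>0. \<alpha> $$ n = 0)"
proof (cases "\<alpha> = 0")
  case True
  thus ?thesis by (simp add: laurent_torus_def angle_norm_def)
next
  case False
  have "card {0, 1 :: 'a} \<le> CARD('a)"
    by (intro card_mono) auto
  hence q: "1 < real CARD('a)"
    by simp
  have "\<alpha> \<in> laurent_torus \<longleftrightarrow> real CARD('a) powi (- fls_subdegree \<alpha>) < real CARD('a) powi 0"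
    using False by (simp add: laurent_torus_def angle_norm_def laurent_ord_def)
  also have "\<dots> \<longleftrightarrow> fls_subdegree \<alpha> > 0"
  proof
    assume "real CARD('a) powi (- fls_subdegree \<alpha>) < real CARD('a) powi 0"
    moreover have "real CARD('a) powi 0 \<le> real CARD('a) powi (- fls_subdegree \<alpha>)"
      if "fls_subdegree \<alpha> \<le> 0"
      using that q by (intro power_int_increasing) auto
    ultimately show "fls_subdegree \<alpha> > 0" by linarith
  next
    assume "fls_subdegree \<alpha> > 0"
    thus "real CARD('a) powi (- fls_subdegree \<alpha>) < real CARD('a) powi 0"
      using q by (intro power_int_strict_increasing) auto
  qed
  also have "\<dots> \<longleftrightarrow> (\<forall>n\<le>0. \<alpha> $$ n = 0)"
    using False nth_fls_subdegree_nonzero[of \<alpha>]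
    by (metis fls_eq0_below_subdegree linorder_not_le order_le_less_trans)
  finally show ?thesis .
qed

lemma frac_part_unique:
  fixes \<alpha> \<beta> :: "'a::{field, finite} fls"
  shows "\<alpha> = laurent_of_poly p + \<beta> \<and> \<beta> \<in> laurent_torus \<longleftrightarrow>
         p = poly_part \<alpha> \<and> \<beta> = frac_part \<alpha>"
proof
  assume *: "\<alpha> = laurent_of_poly p + \<beta> \<and> \<beta> \<in> laurent_torus"
  hence "p = poly_part \<alpha>"
    by (intro poly_eqI)
       (auto simp: poly_part_def laurent_of_poly_nth laurent_torus_iff coeff_pCons split: nat.split)
  with * show "p = poly_part \<alpha> \<and> \<beta> = frac_part \<alpha>"
    unfolding frac_part_def by (metis add_diff_cancel_left')
next
  assume *: "p = poly_part \<alpha> \<and> \<beta> = frac_part \<alpha>"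
  have "frac_part \<alpha> \<in> laurent_torus"
    by (auto simp: laurent_torus_iff frac_part_def laurent_of_poly_nth poly_part_def coeff_pCons
        split: nat.split)
  with * show "\<alpha> = laurent_of_poly p + \<beta> \<and> \<beta> \<in> laurent_torus"
    by (simp add: frac_part_def)
qed

unbundle no fps_syntax

end

theory Submission
  imports Defs "HOL-Computational_Algebra.Polynomial_Factorial"
begin

text \<open>
  Write \<open>M = q + \<dots> + q\<^sup>k\<close>, which is the bound on the size of \<open>F\<close>. A nonzero polynomial of degree
  at most \<open>D\<close> has at most \<open>D div (k + 1)\<close> monic irreducible divisors of degree \<open>k + 1\<close>
  (\<open>card_irreducible_divisors_le\<close>), so the polynomials of \<open>F\<close> together have at most
  \<open>M * (D div (k + 1))\<close> of them. By hypothesis this is less than their total number, hence some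
  monic irreducible \<open>P\<close> of degree \<open>k + 1\<close> divides no element of \<open>F\<close>.

  A lonely point is sought of the form \<open>\<alpha> = a / P\<close> with \<open>a \<noteq> 0\<close> of degree at most \<open>k\<close>. The
  fractional part of \<open>\<alpha> f\<close> is \<open>(a f mod P) / P\<close> (\<open>frac_part_divide\<close>), so
  \<open>|\<alpha> f| \<ge> q\<^bsup>-k\<^esup>\<close> unless \<open>a f\<close> is congruent to a constant modulo \<open>P\<close>. Since \<open>f\<close> is invertible
  modulo \<open>P\<close>, each of the \<open>q - 1\<close> nonzero constants arises from at most one such \<open>a\<close>
  (\<open>card_constant_multiples_le\<close>). The elements of \<open>F\<close> therefore exclude at most
  \<open>M (q - 1) = q\<^bsup>k+1\<^esup> - q\<close> of the \<open>q\<^bsup>k+1\<^esup> - 1\<close> candidates for \<open>a\<close>, and one survives.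
\<close>

section \<open>Rational functions as Laurent series\<close>

lemma CARD_field_ge_2: "CARD('a::{field, finite}) \<ge> 2"
proof -
  have "card {0, 1 :: 'a} \<le> CARD('a)"
    by (intro card_mono) auto
  thus ?thesis by simp
qed

lemma laurent_of_poly_0 [simp]: "laurent_of_poly 0 = 0"
  by (simp add: laurent_of_poly_def)

lemma laurent_of_poly_pCons:
  "laurent_of_poly (pCons a f) = fls_const a + fls_X_inv * laurent_of_poly f"
  by (cases "pCons a f = 0") (auto simp: laurent_of_poly_def map_poly_pCons)

lemma laurent_of_poly_add: "laurent_of_poly (f + g) = laurent_of_poly f + laurent_of_poly g"
  by (rule fls_eqI) (simp add: laurent_of_poly_nth)

lemma laurent_of_poly_smult: "laurent_of_poly (smult c f) = fls_const c * laurent_of_poly f"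
  by (rule fls_eqI) (simp add: laurent_of_poly_nth)

lemma laurent_of_poly_mult: "laurent_of_poly (f * g) = laurent_of_poly f * laurent_of_poly g"
  by (induction f rule: pCons_induct)
     (simp_all add: laurent_of_poly_add laurent_of_poly_smult laurent_of_poly_pCons algebra_simps)

lemma laurent_of_poly_eq_0_iff [simp]: "laurent_of_poly f = 0 \<longleftrightarrow> f = 0"
proof
  assume *: "laurent_of_poly f = 0"
  show "f = 0"
  proof (rule poly_eqI)
    fix n
    have "coeff f n = fls_nth (laurent_of_poly f) (- int n)"
      by (simp add: laurent_of_poly_nth)
    with * show "coeff f n = coeff 0 n" by simp
  qed
qed simp

lemma fls_subdegree_laurent_of_poly: "fls_subdegree (laurent_of_poly f) = - int (degree f)"
proof (cases "f = 0")
  case False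
  thus ?thesis
    by (intro fls_subdegree_eqI) (auto simp: laurent_of_poly_nth coeff_eq_0)
qed simp

lemma laurent_ord_divide:
  assumes "r \<noteq> 0" "P \<noteq> 0"
  shows "laurent_ord (laurent_of_poly r / laurent_of_poly P) = int (degree r) - int (degree P)"
  using assms by (simp add: laurent_ord_def fls_divide_subdegree fls_subdegree_laurent_of_poly)

lemma divide_in_laurent_torus:
  fixes r P :: "'a::{field, finite} poly"
  assumes "degree r < degree P"
  shows "laurent_of_poly r / laurent_of_poly P \<in> laurent_torus"
proof (cases "r = 0")
  case True
  thus ?thesis by (simp add: laurent_torus_def angle_norm_def)
next
  case False
  from assms have "P \<noteq> 0" by auto
  have "real CARD('a) powi (int (degree r) - int (degree P)) < real CARD('a) powi 0"
    using assms CARD_field_ge_2[where 'a='a] by (intro power_int_strict_increasing) auto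
  with False \<open>P \<noteq> 0\<close> show ?thesis
    by (simp add: laurent_torus_def angle_norm_def laurent_ord_divide)
qed

lemma frac_part_divide:
  fixes g P :: "'a::{field, finite} poly"
  assumes "degree P > 0"
  shows "frac_part (laurent_of_poly g / laurent_of_poly P) =
         laurent_of_poly (g mod P) / laurent_of_poly P"
proof -
  from assms have "P \<noteq> 0" by auto
  have "laurent_of_poly g = laurent_of_poly (g div P) * laurent_of_poly P + laurent_of_poly (g mod P)"
    by (simp flip: laurent_of_poly_mult laurent_of_poly_add)
  hence "laurent_of_poly g / laurent_of_poly P =
         laurent_of_poly (g div P) + laurent_of_poly (g mod P) / laurent_of_poly P"
    using \<open>P \<noteq> 0\<close> by (simp add: field_simps)
  moreover have "laurent_of_poly (g mod P) / laurent_of_poly P \<in> laurent_torus"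
    using assms \<open>P \<noteq> 0\<close> degree_mod_less[of P g] by (intro divide_in_laurent_torus) auto
  ultimately show ?thesis
    by (intro frac_part_unique[THEN iffD1, THEN conjunct2, symmetric] conjI)
qed

lemma frac_norm_divide_ge:
  fixes g P :: "'a::{field, finite} poly"
  assumes "degree P = k + 1" "degree (g mod P) > 0"
  shows "frac_norm (laurent_of_poly g / laurent_of_poly P) \<ge> real CARD('a) powi (- int k)"
proof -
  from assms have "P \<noteq> 0" "g mod P \<noteq> 0" by auto
  thus ?thesis
    using assms CARD_field_ge_2[where 'a='a]
    by (auto simp: frac_norm_def frac_part_divide angle_norm_def laurent_ord_divide
             intro!: power_int_increasing)
qed

section \<open>Counting polynomials over a finite field\<close>

lemma monic_irreducible_dvd_imp_eq:
  fixes P Q :: "'a::field poly"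
  assumes "irreducible P" "irreducible Q" "lead_coeff P = 1" "lead_coeff Q = 1" "P dvd Q"
  shows "P = Q"
proof -
  obtain c where c: "Q = P * c" using assms(5) by (elim dvdE)
  have "c dvd 1"
    using irreducibleD[OF assms(2) c] irreducible_not_unit[OF assms(1)] by blast
  then obtain u where u: "c = [:u:]" by (auto simp: is_unit_poly_iff)
  have "lead_coeff Q = lead_coeff P * lead_coeff c"
    unfolding c by (rule lead_coeff_mult)
  with assms(3,4) u have "u = 1" by simp
  with c u show ?thesis by (simp add: one_pCons)
qed

text \<open>
  Distinct monic irreducible polynomials do not divide each other, so their divisibilities into
  \<open>f\<close> add up in degree: after one factor is split off, the others still divide the cofactor.
\<close>
lemma card_irreducible_divisors_le:
  fixes f :: "'a::field poly"
  assumes "finite S"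
    and "\<And>P. P \<in> S \<Longrightarrow> irreducible P \<and> lead_coeff P = 1 \<and> degree P = m"
    and "f \<noteq> 0" and "\<And>P. P \<in> S \<Longrightarrow> P dvd f"
  shows "card S * m \<le> degree f"
  using assms
proof (induction S arbitrary: f rule: finite_induct)
  case (insert P S)
  obtain g where g: "f = P * g" using insert.prems(3) by (auto elim: dvdE)
  with insert.prems(2) have "P \<noteq> 0" "g \<noteq> 0" by auto
  have "Q dvd g" if Q: "Q \<in> S" for Q
  proof -
    have "prime_elem Q"
      using insert.prems(1) Q by (intro field_poly_irreducible_imp_prime) auto
    moreover have "Q dvd P * g" using insert.prems(3) Q g by auto
    moreover have "\<not> Q dvd P"
      using monic_irreducible_dvd_imp_eq[of Q P] insert.prems(1) insert.hyps(2) Q by auto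
    ultimately show ?thesis by (auto simp: prime_elem_dvd_mult_iff)
  qed
  hence "card S * m \<le> degree g"
    using insert.prems(1) \<open>g \<noteq> 0\<close> by (intro insert.IH) auto
  thus ?case
    using insert.hyps insert.prems(1) g \<open>P \<noteq> 0\<close> \<open>g \<noteq> 0\<close> by (simp add: degree_mult_eq)
qed simp

text \<open>Coefficient lists of length \<open>n + 1\<close> biject with the polynomials of degree at most \<open>n\<close>.\<close>
lemma finite_card_degree_le:
  "finite {p :: 'a::{field, finite} poly. degree p \<le> n}"
  "card {p :: 'a poly. degree p \<le> n} = CARD('a) ^ (n + 1)"
proof -
  define L where "L = {xs :: 'a list. length xs = n + 1}"
  have "inj_on Poly L"
  proof
    fix xs ys assume *: "xs \<in> L" "ys \<in> L" "Poly xs = Poly ys"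
    have "xs ! i = ys ! i" if "i < n + 1" for i
    proof -
      have "nth_default 0 xs i = nth_default 0 ys i"
        using *(3) by (metis coeff_Poly_eq)
      with *(1,2) that show ?thesis by (simp add: L_def nth_default_nth)
    qed
    with * show "xs = ys" by (auto simp: L_def intro: nth_equalityI)
  qed
  moreover have "Poly ` L = {p. degree p \<le> n}"
  proof (intro equalityI subsetI)
    fix p assume "p \<in> Poly ` L"
    then obtain xs where xs: "xs \<in> L" "p = Poly xs" by auto
    hence "coeff p i = 0" if "i > n" for i
      using that by (simp add: L_def coeff_Poly_eq nth_default_beyond)
    thus "p \<in> {p. degree p \<le> n}" by (auto intro: degree_le)
  next
    fix p :: "'a poly" assume p: "p \<in> {p. degree p \<le> n}"
    have "p = Poly (map (coeff p) [0..<n + 1])"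
    proof (rule poly_eqI)
      fix i
      show "coeff p i = coeff (Poly (map (coeff p) [0..<n + 1])) i"
        using p by (cases "i < n + 1")
          (auto simp: coeff_Poly_eq nth_default_def coeff_eq_0 simp del: upt_Suc)
    qed
    thus "p \<in> Poly ` L" by (rule image_eqI) (simp add: L_def)
  qed
  ultimately have "bij_betw Poly L {p. degree p \<le> n}"
    by (simp add: bij_betw_def)
  moreover have "card L = CARD('a) ^ (n + 1)" "finite L"
    using card_lists_length_eq[of "UNIV :: 'a set" "n + 1"]
      finite_lists_length_eq[of "UNIV :: 'a set" "n + 1"] by (auto simp: L_def)
  ultimately show "finite {p :: 'a poly. degree p \<le> n}"
    "card {p :: 'a poly. degree p \<le> n} = CARD('a) ^ (n + 1)"
    by (auto simp: bij_betw_finite dest: bij_betw_same_card)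
qed

text \<open>
  The map from \<open>a\<close> to the constant \<open>a f mod P\<close> is injective on the set below, and it misses \<open>0\<close>,
  because \<open>f\<close> is invertible modulo \<open>P\<close>. The condition \<open>degree = 0\<close> formally also admits the
  remainder \<open>0\<close>.
\<close>
lemma card_constant_multiples_le:
  fixes f P :: "'a::{field, finite} poly"
  assumes "irreducible P" "\<not> P dvd f"
  shows "card {a. a \<noteq> 0 \<and> degree a < degree P \<and> degree (a * f mod P) = 0} \<le> CARD('a) - 1"
    (is "card ?B \<le> _")
proof -
  have prime: "prime_elem P"
    using assms(1) by (rule field_poly_irreducible_imp_prime)
  have eq: "a = b" if "degree a < degree P" "degree b < degree P" "a * f mod P = b * f mod P" for a b
  proof (rule ccontr)
    assume "a \<noteq> b"
    have "P dvd (a - b) * f"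
      using that(3) by (simp add: left_diff_distrib mod_eq_dvd_iff)
    with prime assms(2) have "P dvd a - b" by (auto simp: prime_elem_dvd_mult_iff)
    with \<open>a \<noteq> b\<close> have "degree P \<le> degree (a - b)" by (intro dvd_imp_degree_le) auto
    with that(1,2) show False
      using degree_diff_le_max[of a b] by auto
  qed
  define \<phi> where "\<phi> = (\<lambda>a. coeff (a * f mod P) 0)"
  have const: "a * f mod P = [:\<phi> a:]" if "a \<in> ?B" for a
    using that by (auto simp: \<phi>_def elim!: degree_eq_zeroE)
  have "inj_on \<phi> ?B"
  proof
    fix a b assume *: "a \<in> ?B" "b \<in> ?B" "\<phi> a = \<phi> b"
    have "a * f mod P = b * f mod P"
      unfolding const[OF *(1)] const[OF *(2)] *(3) ..
    with *(1,2) show "a = b" using eq[of a b] by blast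
  qed
  moreover have "\<phi> ` ?B \<subseteq> UNIV - {0}"
  proof (rule image_subsetI)
    fix a assume a: "a \<in> ?B"
    have "\<phi> a \<noteq> 0"
    proof
      assume "\<phi> a = 0"
      hence "a * f mod P = 0 * f mod P" using const[OF a] by simp
      with a show False using eq[of a 0] by auto
    qed
    thus "\<phi> a \<in> UNIV - {0}" by simp
  qed
  ultimately have "card ?B \<le> card (UNIV - {0 :: 'a})"
    by (intro card_inj_on_le[of \<phi>]) auto
  thus ?thesis by simp
qed

section \<open>The lower bound for the loneliness\<close>

lemma ex_irreducible_not_dvd:
  fixes F :: "'a::{field, finite} poly set"
  assumes "finite F" "0 \<notin> F" "\<forall>f\<in>F. degree f \<le> D" "m > 0"
    and less: "card F * (D div m) < num_irreducible_monic TYPE('a) m"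
  shows "\<exists>P :: 'a poly. irreducible P \<and> lead_coeff P = 1 \<and> degree P = m \<and> (\<forall>f\<in>F. \<not> P dvd f)"
proof (rule ccontr)
  assume none: "\<not> ?thesis"
  define I where "I = {P :: 'a poly. irreducible P \<and> lead_coeff P = 1 \<and> degree P = m}"
  have "finite I"
    by (rule finite_subset[OF _ finite_card_degree_le(1)[of m]]) (auto simp: I_def)
  have "card I \<le> card (\<Union>f\<in>F. {P\<in>I. P dvd f})"
  proof (rule card_mono)
    show "finite (\<Union>f\<in>F. {P\<in>I. P dvd f})"
      using \<open>finite I\<close> \<open>finite F\<close> by simp
    show "I \<subseteq> (\<Union>f\<in>F. {P\<in>I. P dvd f})"
      using none by (auto simp: I_def)
  qed
  also have "\<dots> \<le> (\<Sum>f\<in>F. card {P\<in>I. P dvd f})"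
    using \<open>finite F\<close> by (rule card_UN_le)
  also have "\<dots> \<le> (\<Sum>f\<in>F. D div m)"
  proof (rule sum_mono)
    fix f assume f: "f \<in> F"
    have "card {P\<in>I. P dvd f} * m \<le> degree f"
    proof (rule card_irreducible_divisors_le)
      show "finite {P\<in>I. P dvd f}" using \<open>finite I\<close> by simp
      show "f \<noteq> 0" using f assms(2) by auto
    qed (auto simp: I_def)
    also have "\<dots> \<le> D" using f assms(3) by auto
    finally show "card {P\<in>I. P dvd f} \<le> D div m"
      using \<open>m > 0\<close> by (simp add: less_eq_div_iff_mult_less_eq)
  qed
  also have "\<dots> = card F * (D div m)" by simp
  finally show False using less by (simp add: num_irreducible_monic_def I_def)
qed

lemma ex_nonconstant_multiplier:
  fixes F :: "'a::{field, finite} poly set"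
  assumes "finite F" "irreducible P" "degree P = k + 1" "\<forall>f\<in>F. \<not> P dvd f"
    and less: "card F * (CARD('a) - 1) < CARD('a) ^ (k + 1) - 1"
  shows "\<exists>a. degree a \<le> k \<and> (\<forall>f\<in>F. degree (a * f mod P) > 0)"
proof (rule ccontr)
  assume none: "\<not> ?thesis"
  define A where "A = {a :: 'a poly. degree a \<le> k} - {0}"
  define B where "B = (\<lambda>f. {a. a \<noteq> 0 \<and> degree a < degree P \<and> degree (a * f mod P) = 0})"
  have "finite (B f)" for f
    by (rule finite_subset[OF _ finite_card_degree_le(1)[of k]]) (auto simp: B_def assms(3))
  moreover have "A \<subseteq> (\<Union>f\<in>F. B f)"
    using none by (auto simp: A_def B_def assms(3) less_Suc_eq_le)
  ultimately have "card A \<le> card (\<Union>f\<in>F. B f)"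
    using \<open>finite F\<close> by (intro card_mono) auto
  also have "\<dots> \<le> (\<Sum>f\<in>F. card (B f))"
    using \<open>finite F\<close> by (rule card_UN_le)
  also have "\<dots> \<le> (\<Sum>f\<in>F. CARD('a) - 1)"
    unfolding B_def using assms by (intro sum_mono card_constant_multiples_le) auto
  also have "\<dots> = card F * (CARD('a) - 1)" by simp
  finally show False
    using less finite_card_degree_le[of k, where 'a='a] by (simp add: A_def)
qed

theorem theorem1p6:
  fixes k D q :: nat
    and F :: "'a::{field, finite} poly set"
  assumes "k > 1"
    and "D > 0"
    and "q = CARD('a)"
    and "real (num_irreducible_monic TYPE('a) (k + 1)) / (\<Sum>i=1..k. real q ^ i)
           > real_of_int \<lfloor>real D / real (k + 1)\<rfloor>"
    and "finite F"
    and "0 \<notin> F"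
    and "real (card F) \<le> (real q ^ (k + 1) - 1) / (real q - 1) - 1"
    and "\<forall>f\<in>F. degree f \<le> D"
  shows "loneliness F \<ge> ereal (real q powi (- int k))"
proof -
  have q: "q \<ge> 2" using CARD_field_ge_2[where 'a='a] assms(3) by simp
  define M where "M = (\<Sum>i=1..k. real q ^ i)"
  have "M * (real q - 1) = real q ^ (k + 1) - real q"
    unfolding M_def by (induction k) (simp_all add: algebra_simps)
  with q have M: "(real q ^ (k + 1) - 1) / (real q - 1) - 1 = M"
    by (simp add: field_simps)
  have "M > 0"
    unfolding M_def using q \<open>k > 1\<close> by (intro sum_pos) auto
  have "real (card F * (D div (k + 1))) = real (card F) * real (D div (k + 1))"
    by simp
  also have "\<dots> \<le> M * real (D div (k + 1))"
    using assms(7) unfolding M by (intro mult_right_mono) auto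
  also have "real (D div (k + 1)) = real_of_int \<lfloor>real D / real (k + 1)\<rfloor>"
    by (metis floor_divide_of_nat_eq of_int_of_nat_eq)
  also have "M * \<dots> < real (num_irreducible_monic TYPE('a) (k + 1))"
    using assms(4) \<open>M > 0\<close> unfolding M_def[symmetric]
    by (simp only: pos_less_divide_eq mult.commute)
  finally have "card F * (D div (k + 1)) < num_irreducible_monic TYPE('a) (k + 1)"
    by linarith
  then obtain P :: "'a poly" where P: "irreducible P" "degree P = k + 1" "\<forall>f\<in>F. \<not> P dvd f"
    using ex_irreducible_not_dvd[OF assms(5,6,8), of "k + 1"] by auto
  \<comment> \<open>The excluded numerators fall short of the \<open>q\<^bsup>k+1\<^esup> - 1\<close> nonzero ones exactly because \<open>q > 1\<close>.\<close>
  have "real (card F) * (real q - 1) \<le> M * (real q - 1)"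
    using assms(7) q unfolding M by (intro mult_right_mono) auto
  also have "\<dots> = real q ^ (k + 1) - real q" by fact
  also have "\<dots> < real q ^ (k + 1) - 1" using q by simp
  finally have "real (card F * (q - 1)) < real (q ^ (k + 1) - 1)"
    using q by (simp add: of_nat_diff)
  hence "card F * (q - 1) < q ^ (k + 1) - 1" by linarith
  then obtain a where a: "degree a \<le> k" "\<forall>f\<in>F. degree (a * f mod P) > 0"
    using ex_nonconstant_multiplier[OF assms(5) P] assms(3) by auto
  define \<alpha> where "\<alpha> = laurent_of_poly a / laurent_of_poly P"
  have "\<alpha> \<in> laurent_torus"
    unfolding \<alpha>_def using a(1) P(2) by (intro divide_in_laurent_torus) simp
  moreover have "ereal (real q powi (- int k)) \<le> (INF f\<in>F. ereal (frac_norm (\<alpha> * laurent_of_poly f)))"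
  proof (rule INF_greatest)
    fix f assume "f \<in> F"
    have "\<alpha> * laurent_of_poly f = laurent_of_poly (a * f) / laurent_of_poly P"
      by (simp add: \<alpha>_def laurent_of_poly_mult)
    thus "ereal (real q powi (- int k)) \<le> ereal (frac_norm (\<alpha> * laurent_of_poly f))"
      using frac_norm_divide_ge[OF P(2), of "a * f"] a(2) \<open>f \<in> F\<close> assms(3) by simp
  qed
  ultimately show ?thesis
    unfolding loneliness_def by (rule SUP_upper2)
qed

end
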